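(* (i) Let $r>1$ be an integer and $\alpha>0$ a real number, and define $$f_{\alpha}^{[r]}(x)=(1+x)^{-r\alpha}\sum_{k=0}^{\infty}\binom{-\alpha}{k}^r\left(\frac{x}{1+x}\right)^{rk},\quad x\geq 0.$$ Then for every $m\in\mathbb{N}\cup\{0\}$, $$\lim_{x\to\infty}\left(\frac{d}{dx}\right)^m f_{\alpha}^{[r]}(x)=0.$$ (ii) Let $c>0$ be real, $n$ a positive integer and $r>1$ an integer, and define $$\psi_{n,c}^{[r]}(x)=\sum_{k=0}^{\infty}\left(p_{n,k}^{[c]}(x)\right)^r,\quad x\geq 0.$$ Then for every $m\in\mathbb{N}\cup\{0\}$, $$\lim_{x\to\infty}\left(\frac{d}{dx}\right)^m\psi_{n,c}^{[r]}(x)=0.$$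
   Context: For $n\in\mathbb{N}$, $k\in\mathbb{N}\cup\{0\}$ and real $c>0$, the (generalized) Baskakov basis functions are $$p_{n,k}^{[c]}(x)=\binom{-n/c}{k}(-cx)^k(1+cx)^{-n/c-k},\quad x\geq 0,$$ where $\binom{a}{k}=\frac{a(a-1)\cdots(a-k+1)}{k!}$ is the generalized binomial coefficient and $0^0=1$. *)

theory Defs
  imports "HOL-Analysis.Analysis"
begin

definition baskakov_basis :: "real \<Rightarrow> nat \<Rightarrow> nat \<Rightarrow> real \<Rightarrow> real" where
  "baskakov_basis c n k x =
     ((- (real n / c)) gchoose k) * (- (c * x)) ^ k * (1 + c * x) powr (- (real n / c) - real k)"

text \<open>The functions below are meant on \<open>x \<ge> 0\<close> only, where both series converge; their
  values at negative arguments carry no meaning.\<close>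

definition f_series :: "nat \<Rightarrow> real \<Rightarrow> real \<Rightarrow> real" where
  "f_series r \<alpha> x =
     (1 + x) powr (- (real r * \<alpha>)) * (\<Sum>k. ((- \<alpha>) gchoose k) ^ r * (x / (1 + x)) ^ (r * k))"

definition psi_series :: "nat \<Rightarrow> nat \<Rightarrow> real \<Rightarrow> real \<Rightarrow> real" where
  "psi_series r n c x = (\<Sum>k. (baskakov_basis c n k x) ^ r)"

end

(*
  Both functions extend to the half plane Re z > 0 as
  F(z) = (1 + c z)^(-r a) * sum_k A_k W^(r k) with W = c z / (1 + c z), because |W| < 1 there.
  By the Gamma asymptotics of binomial coefficients, |A_k| <= |binom(-a, k)|^r is at most a
  multiple of |binom(-b, k)| for some b < r a, so the series is O((1 - |W|^2)^(-b)).  Since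
  1 - |W|^2 = (1 + 2 c Re z) / |1 + c z|^2, this is O(|1 + c z|^b) on the unit circle around a
  large real R, and F = O(R^(b - r a)) there.  Cauchy's estimate on this circle bounds every
  derivative at R by the same vanishing quantity.
*)

theory Submission
  imports Defs "HOL-Complex_Analysis.Complex_Analysis"
begin

section \<open>Negative binomial coefficients: signs, generating series, growth\<close>

lemma abs_gbinomial_neg:
  assumes "0 < (a::real)"
  shows "\<bar>(- a) gchoose n\<bar> = (-1) ^ n * ((- a) gchoose n)" and "(- a) gchoose n \<noteq> 0"
proof -
  have eq: "(- a) gchoose n = (-1) ^ n * (pochhammer a n / fact n)"
    by (simp add: gbinomial_pochhammer)
  have pos: "pochhammer a n / fact n > 0"
    using assms by (simp add: pochhammer_pos)
  show "\<bar>(- a) gchoose n\<bar> = (-1) ^ n * ((- a) gchoose n)"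
    unfolding eq abs_mult power_abs using abs_of_pos[OF pos]
    by (simp add: power_mult_distrib [symmetric] flip: mult.assoc power_add)
  show "(- a) gchoose n \<noteq> 0"
    unfolding eq using less_imp_neq[OF pos] by auto
qed

text \<open>At argument \<open>- t\<close> the alternating signs of coefficients and powers cancel,
  so the binomial series has nonnegative terms and can serve as a majorant.\<close>

lemma abs_gbinomial_neg_sums:
  assumes "0 < (b::real)" "0 \<le> t" "t < 1"
  shows "(\<lambda>k. \<bar>(- b) gchoose k\<bar> * t ^ k) sums (1 - t) powr (- b)"
proof -
  have "(\<lambda>k. ((- b) gchoose k) * (- t) ^ k) sums (1 + - t) powr (- b)"
    using assms by (intro gen_binomial_real) auto
  moreover have "((- b) gchoose k) * (- t) ^ k = \<bar>(- b) gchoose k\<bar> * t ^ k" for k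
    unfolding abs_gbinomial_neg(1)[OF assms(1)] by (subst power_minus) (simp add: mult_ac)
  ultimately show ?thesis by simp
qed

lemma abs_gbinomial_neg_asymptotic:
  assumes "0 < (a::real)"
  shows "(\<lambda>n. \<bar>(- a) gchoose n\<bar> * real n powr (1 - a)) \<longlonglongrightarrow> inverse (Gamma a)"
proof -
  have "(\<lambda>n. ((- a) gchoose n) / ((-1)^n / exp ((- a + 1) * of_real (ln (real n)))))
          \<longlonglongrightarrow> inverse (Gamma (- (- a)))"
    by (rule gbinomial_asymptotic)
  then have lim: "(\<lambda>n. ((- a) gchoose n) / ((-1)^n / exp ((- a + 1) * ln (real n))))
          \<longlonglongrightarrow> inverse (Gamma a)"
    by simp
  have ev: "\<forall>\<^sub>F n in sequentially. ((- a) gchoose n) / ((-1)^n / exp ((- a + 1) * ln (real n)))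
          = \<bar>(- a) gchoose n\<bar> * real n powr (1 - a)"
    \<comment> \<open>At \<open>n = 0\<close> the two expressions differ:
      \<open>0 powr (1 - a)\<close> is 0, whereas the exponential is positive.\<close>
    using eventually_gt_at_top[of 0]
  proof eventually_elim
    case (elim n)
    have "(x::real) / ((-1)^n / y) = (-1)^n * x * y" for x y
      by (cases "even n") auto
    then show ?case
      unfolding abs_gbinomial_neg(1)[OF assms] using elim by (simp add: powr_def)
  qed
  show ?thesis
    using Lim_transform_eventually[OF lim ev] .
qed

text \<open>The two sides grow like the powers of \<open>n\<close> with exponents
  \<open>r * (a - 1)\<close> and \<open>b - 1\<close>, and \<open>le\<close> is precisely the
  comparison of these exponents.\<close>

lemma abs_gbinomial_neg_power_le:
  fixes a b :: real and r :: nat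
  assumes a: "0 < a" and b: "0 < b" and le: "real r * a - b \<le> real r - 1"
  shows "\<exists>C\<ge>0. \<forall>n. \<bar>(- a) gchoose n\<bar> ^ r \<le> C * \<bar>(- b) gchoose n\<bar>"
proof -
  \<comment> \<open>The quotient of the two sides, each normalized by its growth. It converges
    because the denominator has the nonzero limit \<open>inverse (Gamma b)\<close>, and is therefore
    bounded.\<close>
  define Q where "Q n = (\<bar>(- a) gchoose n\<bar> * real n powr (1 - a)) ^ r /
                        (\<bar>(- b) gchoose n\<bar> * real n powr (1 - b))" for n
  have "Gamma b > 0" using b by (rule Gamma_real_pos)
  then have "Q \<longlonglongrightarrow> inverse (Gamma a) ^ r / inverse (Gamma b)"
    unfolding Q_def
    by (intro tendsto_intros abs_gbinomial_neg_asymptotic a b) simp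
  then have "Bseq Q"
    by (intro convergent_imp_Bseq convergentI)
  then obtain K where K: "\<And>n. \<bar>Q n\<bar> \<le> K" and K0: "K > 0"
    unfolding Bseq_def by auto
  \<comment> \<open>\<open>K\<close> serves for \<open>n > 0\<close>; at \<open>n = 0\<close>, where
    \<open>Q\<close> says nothing about the coefficients, both of them are 1 and the constant 1
    suffices.\<close>
  have "\<bar>(- a) gchoose n\<bar> ^ r \<le> max K 1 * \<bar>(- b) gchoose n\<bar>" for n
  proof (cases "n = 0")
    case False
    let ?e = "real r * (1 - a) - (1 - b)"
    have pos: "\<bar>(- b) gchoose n\<bar> > 0"
      using abs_gbinomial_neg(2)[OF b] by simp
    have e: "(real n powr (1 - a)) ^ r = real n powr ?e * real n powr (1 - b)"
      using False by (simp add: powr_power mult.commute flip: powr_add)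
    have "Q n = \<bar>(- a) gchoose n\<bar> ^ r / \<bar>(- b) gchoose n\<bar> * real n powr ?e"
      unfolding Q_def power_mult_distrib e using False by simp
    moreover have "1 \<le> real n powr ?e"
      using False le by (intro ge_one_powr_ge_zero) (auto simp: algebra_simps)
    ultimately have "\<bar>(- a) gchoose n\<bar> ^ r / \<bar>(- b) gchoose n\<bar> \<le> Q n"
      using mult_left_mono[of 1 "real n powr ?e" "\<bar>(- a) gchoose n\<bar> ^ r / \<bar>(- b) gchoose n\<bar>"]
      by simp
    also have "\<dots> \<le> max K 1"
      using K[of n] by simp
    finally show ?thesis
      using pos by (simp add: field_simps)
  qed simp
  then show ?thesis
    by (intro exI[of _ "max K 1"]) auto
qed

section \<open>Derivatives on the real axis through Cauchy's estimate\<close>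

lemma real_higher_deriv_eq_Re:
  fixes f :: "real \<Rightarrow> real" and F :: "complex \<Rightarrow> complex"
  assumes S: "open S" and F: "F holomorphic_on S" and T: "open T"
    and TS: "\<And>x. x \<in> T \<Longrightarrow> of_real x \<in> S"
    and eq: "\<And>x. x \<in> T \<Longrightarrow> f x = Re (F (of_real x))"
    and x: "x \<in> T"
  shows "(deriv ^^ m) f x = Re ((deriv ^^ m) F (of_real x))"
  using x
proof (induction m arbitrary: x)
  case 0
  then show ?case using eq by simp
next
  case (Suc m)
  let ?G = "(deriv ^^ m) F"
  have "?G holomorphic_on S"
    using holomorphic_higher_deriv[OF F S] .
  then have "(?G has_field_derivative deriv ?G (of_real x)) (at (of_real x))"
    using holomorphic_derivI S TS Suc.prems by blast
  then have "((\<lambda>x. ?G (of_real x)) has_vector_derivative deriv ?G (of_real x)) (at x)"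
    by (rule has_vector_derivative_real_field)
  then have "((\<lambda>x. Re (?G (of_real x))) has_vector_derivative Re (deriv ?G (of_real x))) (at x)"
    by (rule bounded_linear.has_vector_derivative[OF bounded_linear_Re])
  then have "((\<lambda>x. Re (?G (of_real x))) has_field_derivative Re (deriv ?G (of_real x))) (at x)"
    by (simp add: has_real_derivative_iff_has_vector_derivative)
  \<comment> \<open>The induction hypothesis identifies the two functions only on \<open>T\<close>;
    since \<open>T\<close> is open, this is enough to transfer the derivative at
    \<open>x\<close>.\<close>
  then have "((deriv ^^ m) f has_field_derivative Re (deriv ?G (of_real x))) (at x)"
    by (rule has_field_derivative_transform_within_open[OF _ T Suc.prems]) (simp add: Suc.IH)
  then show ?case
    by (simp add: DERIV_imp_deriv)
qed

text \<open>Radius 1 serves for every \<open>R > 1\<close>: the closed disc stays in the half plane,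
  and Cauchy's estimate costs only the factor \<open>fact m\<close>, independent of
  \<open>R\<close>. Hence decay of \<open>F\<close> on these circles passes to all
  derivatives.\<close>

lemma higher_deriv_tendsto_0:
  fixes f B :: "real \<Rightarrow> real" and F :: "complex \<Rightarrow> complex"
  assumes F: "F holomorphic_on {z. 0 < Re z}"
    and eq: "\<And>x. 0 < x \<Longrightarrow> f x = Re (F (of_real x))"
    and bound: "\<And>R z. 1 < R \<Longrightarrow> norm (of_real R - z) = 1 \<Longrightarrow> norm (F z) \<le> B R"
    and B: "(B \<longlongrightarrow> 0) at_top"
  shows "((deriv ^^ m) f \<longlongrightarrow> 0) at_top"
proof (rule Lim_null_comparison)
  show "((\<lambda>R. fact m * B R) \<longlongrightarrow> 0) at_top"
    using tendsto_mult_right_zero[OF B] .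
  show "\<forall>\<^sub>F R in at_top. norm ((deriv ^^ m) f R) \<le> fact m * B R"
    using eventually_gt_at_top[of 1]
  proof eventually_elim
    case (elim R)
    have sub: "cball (of_real R) 1 \<subseteq> {z. 0 < Re z}"
    proof
      fix z :: complex assume "z \<in> cball (of_real R) 1"
      then have "norm (of_real R - z) \<le> 1" by (simp add: dist_norm)
      then have "Re (of_real R - z) \<le> 1" using complex_Re_le_cmod order_trans by blast
      then show "z \<in> {z. 0 < Re z}" using elim by simp
    qed
    have "norm ((deriv ^^ m) F (of_real R)) \<le> fact m * B R / 1 ^ m"
    proof (rule Cauchy_inequality)
      show "F holomorphic_on ball (of_real R) 1"
        using F sub ball_subset_cball holomorphic_on_subset by blast
      show "continuous_on (cball (of_real R) 1) F"
        using F sub holomorphic_on_imp_continuous_on continuous_on_subset by blast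
    qed (use bound elim in auto)
    moreover have "(deriv ^^ m) f R = Re ((deriv ^^ m) F (of_real R))"
      by (rule real_higher_deriv_eq_Re[where S = "{z. 0 < Re z}" and T = "{0<..}"])
         (use F eq elim in \<open>auto simp: open_halfspace_Re_gt\<close>)
    ultimately show ?case
      using abs_Re_le_cmod[of "(deriv ^^ m) F (of_real R)"] by simp
  qed
qed

section \<open>Series bounds and decay on the right half plane\<close>

lemma power_series_bound_gbinomial:
  fixes A :: "nat \<Rightarrow> real"
  assumes A: "\<And>k. \<bar>A k\<bar> \<le> C * \<bar>(- b) gchoose k\<bar>" and b: "0 < b" and t: "norm (t::complex) < 1"
  shows "summable (\<lambda>k. of_real (A k) * t ^ k)"
    and "norm (\<Sum>k. of_real (A k) * t ^ k) \<le> C * (1 - norm t) powr (- b)"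
proof -
  have s: "(\<lambda>k. C * (\<bar>(- b) gchoose k\<bar> * norm t ^ k)) sums (C * (1 - norm t) powr (- b))"
    using t b by (intro sums_mult abs_gbinomial_neg_sums) auto
  have le: "norm (of_real (A k) * t ^ k) \<le> C * (\<bar>(- b) gchoose k\<bar> * norm t ^ k)" for k
    using mult_right_mono[OF A[of k], of "norm t ^ k"] by (simp add: norm_mult norm_power mult_ac)
  show "summable (\<lambda>k. of_real (A k) * t ^ k)"
    by (rule summable_comparison_test'[OF sums_summable[OF s]]) (rule le)
  show "norm (\<Sum>k. of_real (A k) * t ^ k) \<le> C * (1 - norm t) powr (- b)"
    using norm_suminf_le[OF le sums_summable[OF s]] sums_unique[OF s] by simp
qed

text \<open>The map \<open>w / (1 + w)\<close> sends the half plane \<open>Re w > - 1 / 2\<close>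
  onto the unit disc. The identity rests on \<open>|1 + w|^2 - |w|^2 = 1 + 2 * Re w\<close> and
  measures how close the image comes to the unit circle.\<close>

lemma norm_divide_one_plus:
  assumes "0 \<le> Re w"
  shows "1 - (norm (w / (1 + w)))\<^sup>2 = (1 + 2 * Re w) / (norm (1 + w))\<^sup>2"
    and "norm (w / (1 + w)) < 1"
proof -
  have "Re (1 + w) > 0" using assms by simp
  then have "1 + w \<noteq> 0" by (metis less_irrefl zero_complex.sel(1))
  then have n: "(norm (1 + w))\<^sup>2 > 0" by simp
  have "(norm (1 + w))\<^sup>2 - (norm w)\<^sup>2 = 1 + 2 * Re w"
    unfolding cmod_power2 by (simp add: power2_eq_square algebra_simps)
  then show *: "1 - (norm (w / (1 + w)))\<^sup>2 = (1 + 2 * Re w) / (norm (1 + w))\<^sup>2"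
    using n by (simp add: norm_divide power_divide field_simps)
  have "(1 + 2 * Re w) / (norm (1 + w))\<^sup>2 > 0"
    using n assms by simp
  then have "(norm (w / (1 + w)))\<^sup>2 < 1" using * by linarith
  then show "norm (w / (1 + w)) < 1"
    by (simp add: power_less_one_iff abs_square_less_1)
qed

text \<open>Common form of both claims. \<open>A\<close> is bounded rather than prescribed, so that
  signed powers of the coefficients (for \<open>f_series\<close>) and powers of their absolute
  values (for \<open>psi_series\<close>) are both covered.\<close>

lemma higher_deriv_binomial_type_series_tendsto_0:
  fixes f :: "real \<Rightarrow> real" and A :: "nat \<Rightarrow> real" and c a :: real and r m :: nat
  assumes r: "1 < r" and a: "0 < a" and c: "0 < c"
    and A: "\<And>k. \<bar>A k\<bar> \<le> \<bar>(- a) gchoose k\<bar> ^ r"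
    and f: "\<And>x. 0 < x \<Longrightarrow>
      f x = (1 + c * x) powr (- (real r * a)) * (\<Sum>k. A k * ((c * x / (1 + c * x)) ^ r) ^ k)"
  shows "((deriv ^^ m) f \<longlongrightarrow> 0) at_top"
proof -
  \<comment> \<open>\<open>e \<le> 1\<close> is what allows the coefficients to be majorized by those of
    \<open>(1 - t) powr (- b)\<close>; the whole function then decays like \<open>x powr (- e)\<close>.\<close>
  define e where "e = min 1 (real r * a / 2)"
  define b where "b = real r * a - e"
  have ra: "real r * a > 0" using r a by simp
  have e: "0 < e" "e \<le> 1" and b: "0 < b" unfolding b_def e_def using ra by linarith+
  \<comment> \<open>The left side equals \<open>e\<close>, and
    \<open>e \<le> 1 \<le> real r - 1\<close>.\<close>
  have "real r * a - b \<le> real r - 1" using r e by (simp add: b_def)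
  then obtain C where C0: "C \<ge> 0" and C: "\<And>n. \<bar>(- a) gchoose n\<bar> ^ r \<le> C * \<bar>(- b) gchoose n\<bar>"
    using abs_gbinomial_neg_power_le[OF a b] by blast
  have AC: "\<bar>A k\<bar> \<le> C * \<bar>(- b) gchoose k\<bar>" for k
    using A[of k] C[of k] by linarith
  define H :: "complex \<Rightarrow> complex" where "H t = (\<Sum>k. of_real (A k) * t ^ k)" for t
  define W :: "complex \<Rightarrow> complex" where "W z = of_real c * z / (1 + of_real c * z)" for z
  define F where "F z = (1 + of_real c * z) powr of_real (- (real r * a)) * H (W z ^ r)" for z
  have W1: "norm (W z) < 1" "1 + of_real c * z \<notin> \<real>\<^sub>\<le>\<^sub>0" "1 + of_real c * z \<noteq> 0" if "0 < Re z" for z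
  proof -
    have p: "0 < Re (1 + of_real c * z)" using that c by (simp add: add_pos_pos)
    show "norm (W z) < 1"
      unfolding W_def using that c by (intro norm_divide_one_plus(2)) simp
    show "1 + of_real c * z \<notin> \<real>\<^sub>\<le>\<^sub>0"
      using p by (auto simp only: complex_nonpos_Reals_iff)
    show "1 + of_real c * z \<noteq> 0" using p by (metis less_irrefl zero_complex.sel(1))
  qed
  \<comment> \<open>An exponent of at least 2 brings in the square of \<open>norm (W z)\<close>, for
    which \<open>norm_divide_one_plus\<close> gives an exact value.\<close>
  have Wr: "norm (W z ^ r) \<le> (norm (W z))\<^sup>2" "norm (W z ^ r) < 1" if "0 < Re z" for z
  proof -
    show *: "norm (W z ^ r) \<le> (norm (W z))\<^sup>2"
      unfolding norm_power using W1(1)[OF that] r by (intro power_decreasing) auto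
    show "norm (W z ^ r) < 1"
      unfolding norm_power using W1(1)[OF that] r by (simp add: power_less_one_iff)
  qed
  show ?thesis
  proof (rule higher_deriv_tendsto_0)
    have "H holomorphic_on ball 0 1"
      by (rule power_series_holomorphic[where a = "\<lambda>k. of_real (A k)"])
         (use power_series_bound_gbinomial(1)[OF AC b] in \<open>auto simp: H_def summable_sums\<close>)
    moreover have "(\<lambda>z. W z ^ r) holomorphic_on {z. 0 < Re z}"
      unfolding W_def using W1 by (intro holomorphic_intros) auto
    ultimately have "(H \<circ> (\<lambda>z. W z ^ r)) holomorphic_on {z. 0 < Re z}"
      using Wr by (intro holomorphic_on_compose_gen) auto
    then show "F holomorphic_on {z. 0 < Re z}"
      unfolding F_def using W1 by (intro holomorphic_intros) (auto simp: o_def)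
  next
    fix x :: real assume x: "0 < x"
    define y where "y = (c * x / (1 + c * x)) ^ r"
    have Wy: "W (of_real x) ^ r = of_real y" by (simp add: W_def y_def)
    have "H (of_real y) = of_real (\<Sum>k. A k * y ^ k)"
    proof -
      have "summable (\<lambda>k. of_real (A k) * (of_real y) ^ k :: complex)"
        using power_series_bound_gbinomial(1)[OF AC b] Wr(2)[of "of_real x"] x
        unfolding Wy by simp
      then have "summable (\<lambda>k. complex_of_real (A k * y ^ k))" by simp
      then have "summable (\<lambda>k. A k * y ^ k)" using summable_of_real_iff by blast
      from sums_of_real[OF summable_sums[OF this], where ?'a = complex]
      show ?thesis
        unfolding H_def by (simp add: sums_iff)
    qed
    moreover have "(1 + complex_of_real c * of_real x) powr of_real (- (real r * a))
        = of_real ((1 + c * x) powr (- (real r * a)))"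
      using powr_of_real[of "1 + c * x" "- (real r * a)"] x c by (simp add: add_pos_pos less_imp_le)
    ultimately show "f x = Re (F (of_real x))"
      unfolding F_def Wy f[OF x] y_def[symmetric] by (simp flip: of_real_mult del: of_real_minus of_real_mult)
  next
    fix R :: real and z :: complex assume R: "1 < R" and z: "norm (of_real R - z) = 1"
    have "\<bar>Re (of_real R - z)\<bar> \<le> 1" "\<bar>Im (of_real R - z)\<bar> \<le> 1"
      using z abs_Re_le_cmod abs_Im_le_cmod by metis+
    then have Rez: "R - 1 \<le> Re z" and Imz: "\<bar>Im z\<bar> \<le> 1" by auto
    have z0: "0 < Re z" using Rez R by linarith
    define w where "w = of_real c * z"
    have w0: "0 < Re w" using z0 c by (simp add: w_def)
    define D where "D = norm (1 + w)"
    have Dlow: "1 + c * (R - 1) \<le> D"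
    proof -
      have "1 + c * (R - 1) \<le> Re (1 + w)"
        using mult_left_mono[OF Rez, of c] c by (simp add: w_def)
      also have "\<dots> \<le> D" unfolding D_def by (rule complex_Re_le_cmod)
      finally show ?thesis .
    qed
    have D1: "0 < 1 + c * (R - 1)" using c R by (simp add: add_pos_pos)
    then have D0: "0 < D" using Dlow by linarith
    \<comment> \<open>On the circle \<open>Im w\<close> stays bounded by \<open>c\<close>, so
      \<open>D\<close> is at most a multiple of \<open>1 + 2 * Re w\<close>. This makes the gap
      \<open>(1 + 2 * Re w) / D^2\<close> at least of order \<open>1 / D\<close>.\<close>
    have Dup: "D \<le> (1 + c) * (1 + 2 * Re w)"
    proof -
      have "D \<le> \<bar>Re (1 + w)\<bar> + \<bar>Im (1 + w)\<bar>" unfolding D_def by (rule cmod_le)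
      also have "\<bar>Im (1 + w)\<bar> \<le> c"
        using Imz c mult_left_mono[OF Imz, of c] by (simp add: w_def abs_mult)
      also have "\<bar>Re (1 + w)\<bar> + c \<le> (1 + c) * (1 + 2 * Re w)"
        using w0 c by (simp add: algebra_simps)
      finally show ?thesis by simp
    qed
    have Ww: "W z = w / (1 + w)" by (simp add: W_def w_def)
    have "D / (1 + c) \<le> 1 + 2 * Re w"
      using Dup c by (simp add: pos_divide_le_eq mult.commute)
    then have "D / (1 + c) / D\<^sup>2 \<le> (1 + 2 * Re w) / D\<^sup>2"
      by (rule divide_right_mono) simp
    then have "1 / ((1 + c) * D) \<le> (1 + 2 * Re w) / D\<^sup>2"
      using D0 by (simp add: power2_eq_square)
    also have "\<dots> = 1 - (norm (W z))\<^sup>2"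
      unfolding Ww D_def using w0 by (intro norm_divide_one_plus(1)[symmetric]) simp
    also have "\<dots> \<le> 1 - norm (W z ^ r)" using Wr(1)[OF z0] by simp
    finally have low: "1 / ((1 + c) * D) \<le> 1 - norm (W z ^ r)" .
    have "norm (H (W z ^ r)) \<le> C * (1 - norm (W z ^ r)) powr (- b)"
      unfolding H_def by (rule power_series_bound_gbinomial(2)[OF AC b Wr(2)[OF z0]])
    \<comment> \<open>The exponent is negative, so the lower bound on the gap becomes an upper
      bound.\<close>
    also have "\<dots> \<le> C * (1 / ((1 + c) * D)) powr (- b)"
      using low c D0 b C0 by (intro mult_left_mono powr_mono2') auto
    also have "\<dots> = C * (1 + c) powr b * D powr b"
      using c D0 by (simp add: powr_minus powr_divide powr_mult)
    finally have Hb: "norm (H (W z ^ r)) \<le> C * (1 + c) powr b * D powr b" .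
    have "norm (F z) = D powr (- (real r * a)) * norm (H (W z ^ r))"
      unfolding F_def norm_mult D_def w_def by (subst norm_powr_real_powr') auto
    also have "\<dots> \<le> D powr (- (real r * a)) * (C * (1 + c) powr b * D powr b)"
      by (intro mult_left_mono Hb) simp
    also have "\<dots> = C * (1 + c) powr b * (D powr (- (real r * a)) * D powr b)"
      by (simp add: mult_ac)
    also have "D powr (- (real r * a)) * D powr b = D powr (- e)"
      by (simp add: b_def flip: powr_add)
    \<comment> \<open>Replacing \<open>D\<close> by its lower bound under a negative exponent leaves
      a bound that depends on \<open>R\<close> alone, not on \<open>z\<close>.\<close>
    also have "C * (1 + c) powr b * D powr (- e) \<le> C * (1 + c) powr b * (1 + c * (R - 1)) powr (- e)"
      using Dlow D1 e C0 by (intro mult_left_mono powr_mono2') auto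
    finally show "norm (F z) \<le> C * (1 + c) powr b * (1 + c * (R - 1)) powr (- e)" .
  next
    have "filterlim (\<lambda>R. 1 + c * (R - 1)) at_top at_top"
      using c by real_asymp
    then have "((\<lambda>R. (1 + c * (R - 1)) powr (- e)) \<longlongrightarrow> 0) at_top"
      using e by (intro tendsto_neg_powr) auto
    then show "((\<lambda>R. C * (1 + c) powr b * (1 + c * (R - 1)) powr (- e)) \<longlongrightarrow> 0) at_top"
      by (rule tendsto_mult_right_zero)
  qed
qed

section \<open>Baskakov sums as an instance of the common form\<close>

lemma summable_power:
  fixes g :: "nat \<Rightarrow> real"
  assumes g: "summable g" and nonneg: "\<And>k. 0 \<le> g k" and r: "0 < r"
  shows "summable (\<lambda>k. g k ^ r)"
proof (rule summable_comparison_test_ev[OF _ g])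
  \<comment> \<open>Below 1, raising a nonnegative term to the power \<open>r\<close> can only
    decrease it.\<close>
  have "\<forall>\<^sub>F k in sequentially. g k < 1"
    using summable_LIMSEQ_zero[OF g] by (rule order_tendstoD) simp
  then show "\<forall>\<^sub>F k in sequentially. norm (g k ^ r) \<le> g k"
  proof eventually_elim
    case (elim k)
    then show ?case
      using power_decreasing[of 1 r "g k"] nonneg[of k] r by simp
  qed
qed

text \<open>The sign of \<open>(- (c * x)) ^ k\<close> cancels that of the coefficient, and the part
  \<open>- real k\<close> of the exponent turns \<open>(c * x) ^ k\<close> into a power of the
  ratio. This is the common form with \<open>a = real n / c\<close>.\<close>

lemma baskakov_basis_power:
  assumes "0 < c" "0 < n" "0 < x"
  shows "baskakov_basis c n k x ^ r = (1 + c * x) powr (- (real r * (real n / c))) *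
    (\<bar>(- (real n / c)) gchoose k\<bar> ^ r * ((c * x / (1 + c * x)) ^ r) ^ k)"
proof -
  have y: "0 < 1 + c * x" using assms by (simp add: add_pos_pos)
  have nc: "0 < real n / c" using assms by simp
  have "baskakov_basis c n k x = (1 + c * x) powr (- (real n / c)) *
      (\<bar>(- (real n / c)) gchoose k\<bar> * (c * x / (1 + c * x)) ^ k)"
    unfolding baskakov_basis_def abs_gbinomial_neg(1)[OF nc] power_minus[of "c * x"] powr_diff
    using y by (simp add: powr_realpow power_divide)
  then show ?thesis
    using y by (simp add: power_mult_distrib powr_power mult.commute flip: power_mult)
qed

theorem mainTheorem8:
  shows "(\<forall>(r::nat) (\<alpha>::real) (m::nat). r > 1 \<longrightarrow> \<alpha> > 0 \<longrightarrow>
            ((deriv ^^ m) (f_series r \<alpha>) \<longlongrightarrow> 0) at_top) \<and>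
         (\<forall>(c::real) (n::nat) (r::nat) (m::nat). c > 0 \<longrightarrow> n > 0 \<longrightarrow> r > 1 \<longrightarrow>
            ((deriv ^^ m) (psi_series r n c) \<longlongrightarrow> 0) at_top)"
proof (intro conjI allI impI)
  fix r m :: nat and \<alpha> :: real
  assume "r > 1" "\<alpha> > 0"
  then show "((deriv ^^ m) (f_series r \<alpha>) \<longlongrightarrow> 0) at_top"
    by (rule higher_deriv_binomial_type_series_tendsto_0
          [where c = 1 and A = "\<lambda>k. ((- \<alpha>) gchoose k) ^ r"])
       (simp_all add: f_series_def power_abs power_mult)
next
  fix c :: real and n r m :: nat
  assume c: "c > 0" and n: "n > 0" and r: "r > 1"
  then have nc: "0 < real n / c" by simp
  show "((deriv ^^ m) (psi_series r n c) \<longlongrightarrow> 0) at_top"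
  proof (rule higher_deriv_binomial_type_series_tendsto_0[OF r nc c])
    fix x :: real assume x: "0 < x"
    show "psi_series r n c x = (1 + c * x) powr (- (real r * (real n / c))) *
        (\<Sum>k. \<bar>(- (real n / c)) gchoose k\<bar> ^ r * ((c * x / (1 + c * x)) ^ r) ^ k)"
      unfolding psi_series_def baskakov_basis_power[OF c n x]
    proof (rule suminf_mult)
      \<comment> \<open>Pulling the prefactor out of the sum requires convergence: before taking
        powers this is a binomial series at a ratio below 1, and \<open>summable_power\<close>
        passes to \<open>r\<close>-th powers.\<close>
      have "0 < 1 + c * x" using c x by (simp add: add_pos_pos)
      then have "summable (\<lambda>k. \<bar>(- (real n / c)) gchoose k\<bar> * (c * x / (1 + c * x)) ^ k)"
        using c x by (intro sums_summable[OF abs_gbinomial_neg_sums] nc) auto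
      then have "summable (\<lambda>k. (\<bar>(- (real n / c)) gchoose k\<bar> * (c * x / (1 + c * x)) ^ k) ^ r)"
        using c x r by (intro summable_power) auto
      then show "summable (\<lambda>k. \<bar>(- (real n / c)) gchoose k\<bar> ^ r * ((c * x / (1 + c * x)) ^ r) ^ k)"
        by (simp add: power_mult_distrib power_commutes mult.commute flip: power_mult)
    qed
  qed simp
qed

end
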